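(* $\chi^2(\mathbb{Z})\ge 4$.
   Context: Let $S\subseteq\mathbb{R}$ and $k,m\in\mathbb{N}$, and let $D=(d_{ij})$ be a $k\times m$ array of positive real numbers. $S$ is called $D$-colorable if there is a coloring $T:S\to\{C_1,\dots,C_m\}$ such that for all $1\le i\le k$ and $1\le j\le m$, no two points $x,y\in S$ with $|x-y|=d_{ij}$ are both colored $C_j$. The $k^{\rm th}$ upper chromatic number $\chi^k(S)$ is the smallest integer $m$ such that $S$ is $D$-colorable for every $k\times m$ array $D$ of positive reals; if no such integer exists, $\chi^k(S)=\infty$. *)

theory Defs
  imports Complex_Main "HOL-Library.Extended_Nat" "HOL-Library.FuncSet"
begin

text \<open>
  A \<open>k \<times> m\<close> array is a function \<open>D\<close> of which only the entries \<open>D i j\<close> with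
  \<open>1 \<le> i \<le> k\<close> and \<open>1 \<le> j \<le> m\<close> matter; the colour \<open>C\<^sub>j\<close> is represented by \<open>j\<close>.
\<close>

definition pos_array :: "nat \<Rightarrow> nat \<Rightarrow> (nat \<Rightarrow> nat \<Rightarrow> real) \<Rightarrow> bool" where
  "pos_array k m D \<longleftrightarrow> (\<forall>i\<in>{1..k}. \<forall>j\<in>{1..m}. D i j > 0)"

definition D_colorable :: "nat \<Rightarrow> nat \<Rightarrow> (nat \<Rightarrow> nat \<Rightarrow> real) \<Rightarrow> real set \<Rightarrow> bool" where
  "D_colorable k m D S \<longleftrightarrow>
     (\<exists>T \<in> S \<rightarrow> {1..m}. \<forall>i\<in>{1..k}. \<forall>j\<in>{1..m}.
        \<not> (\<exists>x\<in>S. \<exists>y\<in>S. \<bar>x - y\<bar> = D i j \<and> T x = j \<and> T y = j))"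

text \<open>
  The infimum in \<^typ>\<open>enat\<close> is the least element of a nonempty set and \<open>\<infinity>\<close> for the
  empty set. Allowing \<open>m = 0\<close> is harmless: no nonempty \<open>S\<close> can be coloured with no colours.
\<close>

definition upper_chromatic :: "nat \<Rightarrow> real set \<Rightarrow> enat" where
  "upper_chromatic k S =
     Inf {enat m |m. \<forall>D. pos_array k m D \<longrightarrow> D_colorable k m D S}"

end

theory Submission
  imports Defs
begin

text \<open>
  Forbid the distances 1 and 2 for the first two colours and the distances 2 and 3 for the third.
  Among three consecutive integers each of the first two colours occurs at most once, so the third
  colour occurs in every such window. If \<open>x\<close> has the third colour, then \<open>x + 2\<close> and \<open>x + 3\<close> do not,
  hence \<open>x + 1\<close> does; applying this to \<open>x + 1\<close> gives the third colour to \<open>x + 2\<close> as well,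
  a contradiction.
\<close>

lemma no_three_colouring:
  fixes c :: "int \<Rightarrow> nat"
  assumes range: "\<And>x. c x \<in> {1, 2, 3}"
    and dist1: "\<And>x. c x \<noteq> 3 \<Longrightarrow> c (x + 1) \<noteq> c x"
    and dist2: "\<And>x. c (x + 2) \<noteq> c x"
    and dist3: "\<And>x. c x = 3 \<Longrightarrow> c (x + 3) \<noteq> 3"
  shows False
proof -
  have window: "c x = 3 \<or> c (x + 1) = 3 \<or> c (x + 2) = 3" for x
    using range[of x] range[of "x + 1"] range[of "x + 2"] dist1[of x] dist1[of "x + 1"] dist2[of x]
    by (auto simp: add.assoc)
  have step: "c (x + 1) = 3" if "c x = 3" for x
    using window[of "x + 1"] dist2[of x] dist3[of x] that by (auto simp: add.assoc)
  obtain x where x: "c x = 3"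
    using window by blast
  have "c (x + 2) = 3"
    using step[OF step[OF x]] by (simp add: add.assoc)
  with x dist2 show False
    by metis
qed

text \<open>The entries do not depend on the number of colours, so one array refutes every m \<le>
  3.\<close>

definition shifted_array :: "nat \<Rightarrow> nat \<Rightarrow> real" where
  "shifted_array i j = (if j = 3 then real i + 1 else real i)"

lemma pos_array_shifted_array: "pos_array k m shifted_array"
  by (auto simp: pos_array_def shifted_array_def)

lemma not_D_colorable_shifted_array:
  assumes "m \<le> 3"
  shows "\<not> D_colorable 2 m shifted_array \<int>"
proof
  assume "D_colorable 2 m shifted_array \<int>"
  then obtain T where T: "T \<in> \<int> \<rightarrow> {1..m}"
    and forbidden: "\<forall>i\<in>{1..2}. \<forall>j\<in>{1..m}. \<not> (\<exists>x\<in>\<int>. \<exists>y\<in>\<int>.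
      \<bar>x - y\<bar> = shifted_array i j \<and> T x = j \<and> T y = j)"
    unfolding D_colorable_def by (elim bexE)
  have avoid: "\<bar>x - y\<bar> \<noteq> shifted_array i (T x)"
    if "i \<in> {1..2}" "T x \<in> {1..m}" "x \<in> \<int>" "y \<in> \<int>" "T y = T x" for i x y
    using forbidden[rule_format, OF that(1,2)] that(3-5) by blast
  define c where "c x = T (of_int x)" for x :: int
  have c: "c x \<in> {1..m}" for x
    using T unfolding c_def by (auto simp: Pi_iff)
  have dist: "c (x + d) \<noteq> c x" if "i \<in> {1..2}" "real_of_int d = shifted_array i (c x)" for i x d
  proof
    assume "c (x + d) = c x"
    \<comment> \<open>With d replaced by the array entry, nonnegativity removes the absolute value
      and integrality keeps the second point in \<open>\<int>\<close>.\<close>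
    moreover have "shifted_array i (c x) \<ge> 0"
      by (simp add: shifted_array_def)
    moreover have "shifted_array i (c x) \<in> \<int>"
      by (metis that(2) Ints_of_int)
    ultimately show False
      using avoid[of i "of_int x" "of_int (x + d)"] c[of x] that
      by (simp add: c_def)
  qed
  show False
  proof (rule no_three_colouring)
    show "c x \<in> {1, 2, 3}" for x
      using c[of x] assms by auto
    show "c (x + 1) \<noteq> c x" if "c x \<noteq> 3" for x
      using dist[of 1 1 x] that by (simp add: shifted_array_def)
    show "c (x + 2) \<noteq> c x" for x
      \<comment> \<open>Distance 2 is the first entry of column 3 but the second entry of columns 1
        and 2.\<close>
      using dist[of 1 2 x] dist[of 2 2 x] by (cases "c x = 3") (simp_all add: shifted_array_def)
    show "c (x + 3) \<noteq> 3" if "c x = 3" for x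
      using dist[of 2 3 x] that by (simp add: shifted_array_def)
  qed
qed

theorem theorem3: "upper_chromatic 2 (\<int> :: real set) \<ge> 4"
  unfolding upper_chromatic_def
\<comment> \<open>Bounding each member from below also covers an empty set, whose infimum is
  \<infinity>.\<close>
proof (rule Inf_greatest, clarify)
  fix m
  assume "\<forall>D. pos_array 2 m D \<longrightarrow> D_colorable 2 m D \<int>"
  then have "\<not> m \<le> 3"
    using pos_array_shifted_array not_D_colorable_shifted_array by blast
  then have "enat 4 \<le> enat m"
    by simp
  then show "4 \<le> enat m"
    by (simp add: numeral_eq_enat)
qed

end
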